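(* Let $\mathsf h_0(\xi,\eta)=\int_I\frac{\xi^2+\eta^2}{2}\,dy$ and $$\mathsf F_2(\xi,\eta)=\int_I\left(-\frac{[\partial_{y_1}(\xi-\eta)]^2}{48}+\alpha\frac{(\xi+\eta)^3}{3\cdot2^{3/2}}\right)dy ,$$ and let $\langle\mathsf F_2\rangle$ be the average of $\mathsf F_2$ along the flow of $\mathsf h_0$. Then the equations of motion associated to the Hamiltonian $\mathsf h_0+\mu^2\langle\mathsf F_2\rangle$ are $$\begin{cases}\xi_\tau=-\partial_{y_1}\xi-\frac{\mu^2}{24}\partial_{y_1}^3\xi-\frac{\mu^2\alpha}{2\sqrt2}\,\partial_{y_1}(\xi^2)\\[2pt] \eta_\tau=\partial_{y_1}\eta+\frac{\mu^2}{24}\partial_{y_1}^3\eta+\frac{\mu^2\alpha}{2\sqrt2}\,\partial_{y_1}(\eta^2).\end{cases}$$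
   Context: $I=[-1,1]^2$; $\xi,\eta$ are (sufficiently regular) real functions on $I$, 2-periodic in $y_1$ and in $y_2$, with zero average in $y_1$ for every $y_2$. $\alpha\in\mathbb R\setminus\{0\}$ and $\mu>0$ are parameters. Hamilton's equations of a Hamiltonian $\mathsf K(\xi,\eta)$ are, with Poisson tensor $J=\partial_{y_1}\begin{pmatrix}-1&0\\0&1\end{pmatrix}$, $\partial_\tau\xi=-\partial_{y_1}\frac{\delta\mathsf K}{\delta\xi}$, $\partial_\tau\eta=\partial_{y_1}\frac{\delta\mathsf K}{\delta\eta}$. The flow of $\mathsf h_0$ is $\Phi^\tau(\xi,\eta)(y)=(\xi(y_1-\tau,y_2),\eta(y_1+\tau,y_2))$, of period $T=2$, and $\langle\mathsf F_2\rangle(\xi,\eta)=\frac1T\int_0^T\mathsf F_2(\Phi^\tau(\xi,\eta))\,d\tau$. *)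

theory Defs
  imports "HOL-Analysis.Analysis" "HOL-Library.Extended_Nat"
begin

text \<open>Functions on the square that are 2-periodic in both variables are represented by their
  periodic extensions to the whole plane.\<close>

type_synonym field = "real \<times> real \<Rightarrow> real"

definition sq :: "(real \<times> real) set" where
  "sq = {-1..1} \<times> {-1..1}"

definition pd1 :: "field \<Rightarrow> field" ("\<partial>\<^sub>1") where
  "\<partial>\<^sub>1 u = (\<lambda>(y1, y2). deriv (\<lambda>s. u (s, y2)) y1)"

definition pd2 :: "field \<Rightarrow> field" ("\<partial>\<^sub>2") where
  "\<partial>\<^sub>2 u = (\<lambda>(y1, y2). deriv (\<lambda>s. u (y1, s)) y2)"

definition has_pd1 :: "field \<Rightarrow> bool" where
  "has_pd1 u \<longleftrightarrow> (\<forall>y1 y2. (\<lambda>s. u (s, y2)) differentiable (at y1))"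

definition has_pd2 :: "field \<Rightarrow> bool" where
  "has_pd2 u \<longleftrightarrow> (\<forall>y1 y2. (\<lambda>s. u (y1, s)) differentiable (at y2))"

primrec C_k :: "nat \<Rightarrow> field \<Rightarrow> bool" where
  "C_k 0 u \<longleftrightarrow> continuous_on UNIV u"
| "C_k (Suc k) u \<longleftrightarrow>
     continuous_on UNIV u \<and> has_pd1 u \<and> has_pd2 u \<and> C_k k (\<partial>\<^sub>1 u) \<and> C_k k (\<partial>\<^sub>2 u)"

definition periodic2 :: "field \<Rightarrow> bool" where
  "periodic2 u \<longleftrightarrow> (\<forall>y1 y2. u (y1 + 2, y2) = u (y1, y2) \<and> u (y1, y2 + 2) = u (y1, y2))"

definition zero_avg1 :: "field \<Rightarrow> bool" where
  "zero_avg1 u \<longleftrightarrow> (\<forall>y2. integral {-1..1} (\<lambda>y1. u (y1, y2)) = 0)"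

text \<open>The regularity \<open>r\<close> is a parameter; \<open>r = \<infinity>\<close> gives smooth functions.\<close>

definition fields :: "enat \<Rightarrow> field set" where
  "fields r = {u. (\<forall>k. enat k \<le> r \<longrightarrow> C_k k u) \<and> periodic2 u \<and> zero_avg1 u}"

text \<open>Functional derivatives are taken with respect to the \<open>L\<^sup>2\<close> inner product, with variations in
  \<^term>\<open>fields r\<close>. As variations have zero average in \<open>y\<^sub>1\<close>, a functional derivative is only
  determined up to adding a function of \<open>y\<^sub>2\<close>, which \<open>\<partial>\<^sub>1\<close> annihilates; this is why it is a relation.\<close>

definition admissible_grad :: "field \<Rightarrow> bool" where
  "admissible_grad g \<longleftrightarrow> continuous_on UNIV g \<and> periodic2 g \<and> has_pd1 g"

definition func_deriv_xi ::
    "enat \<Rightarrow> (field \<times> field \<Rightarrow> real) \<Rightarrow> field \<times> field \<Rightarrow> field \<Rightarrow> bool" where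
  "func_deriv_xi r K = (\<lambda>(\<xi>, \<eta>) g. admissible_grad g \<and>
     (\<forall>h\<in>fields r. ((\<lambda>e. K ((\<lambda>y. \<xi> y + e * h y), \<eta>))
        has_real_derivative integral sq (\<lambda>y. g y * h y)) (at 0)))"

definition func_deriv_eta ::
    "enat \<Rightarrow> (field \<times> field \<Rightarrow> real) \<Rightarrow> field \<times> field \<Rightarrow> field \<Rightarrow> bool" where
  "func_deriv_eta r K = (\<lambda>(\<xi>, \<eta>) g. admissible_grad g \<and>
     (\<forall>h\<in>fields r. ((\<lambda>e. K (\<xi>, (\<lambda>y. \<eta> y + e * h y)))
        has_real_derivative integral sq (\<lambda>y. g y * h y)) (at 0)))"

text \<open>\<^term>\<open>ham_vf r K w V\<close>: the functional derivatives of \<open>K\<close> at \<open>w\<close> exist and \<open>V = J \<nabla>K(w)\<close>.\<close>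

definition ham_vf ::
    "enat \<Rightarrow> (field \<times> field \<Rightarrow> real) \<Rightarrow> field \<times> field \<Rightarrow> field \<times> field \<Rightarrow> bool" where
  "ham_vf r K w V \<longleftrightarrow> (\<exists>g1 g2. func_deriv_xi r K w g1 \<and> func_deriv_eta r K w g2 \<and>
     V = ((\<lambda>y. - \<partial>\<^sub>1 g1 y), (\<lambda>y. \<partial>\<^sub>1 g2 y)))"

definition hamilton_eqs ::
    "enat \<Rightarrow> (field \<times> field \<Rightarrow> real) \<Rightarrow> real set \<Rightarrow> (real \<Rightarrow> field) \<Rightarrow> (real \<Rightarrow> field) \<Rightarrow> bool" where
  "hamilton_eqs r K S \<xi> \<eta> \<longleftrightarrow> (\<forall>\<tau>\<in>S. \<exists>a b. ham_vf r K (\<xi> \<tau>, \<eta> \<tau>) (a, b) \<and>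
     (\<forall>y. ((\<lambda>t. \<xi> t y) has_real_derivative a y) (at \<tau> within S) \<and>
          ((\<lambda>t. \<eta> t y) has_real_derivative b y) (at \<tau> within S)))"

definition h0 :: "field \<times> field \<Rightarrow> real" where
  "h0 = (\<lambda>(\<xi>, \<eta>). integral sq (\<lambda>y. ((\<xi> y)\<^sup>2 + (\<eta> y)\<^sup>2) / 2))"

definition F2 :: "real \<Rightarrow> field \<times> field \<Rightarrow> real" where
  "F2 \<alpha> = (\<lambda>(\<xi>, \<eta>). integral sq (\<lambda>y.
     - (\<partial>\<^sub>1 (\<lambda>z. \<xi> z - \<eta> z) y)\<^sup>2 / 48 + \<alpha> * (\<xi> y + \<eta> y) ^ 3 / (3 * 2 powr (3 / 2))))"

text \<open>The flow of \<^const>\<open>h0\<close>, whose Hamilton equations are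
  \<open>\<partial>\<^sub>\<tau>\<xi> = - \<partial>\<^sub>1\<xi>\<close>, \<open>\<partial>\<^sub>\<tau>\<eta> = \<partial>\<^sub>1\<eta>\<close>; it has period 2.\<close>

definition flow_h0 :: "real \<Rightarrow> field \<times> field \<Rightarrow> field \<times> field" where
  "flow_h0 \<tau> = (\<lambda>(\<xi>, \<eta>). ((\<lambda>(y1, y2). \<xi> (y1 - \<tau>, y2)), (\<lambda>(y1, y2). \<eta> (y1 + \<tau>, y2))))"

definition flow_avg :: "(field \<times> field \<Rightarrow> real) \<Rightarrow> field \<times> field \<Rightarrow> real" where
  "flow_avg F w = (1 / 2) * integral {0..2} (\<lambda>\<tau>. F (flow_h0 \<tau> w))"

end

theory Submission
  imports Defs
begin

text \<open>Expand \<^term>\<open>F2 \<alpha>\<close> along the flow: the terms that contain only \<open>\<xi>\<close> or only \<open>\<eta>\<close> are invariant under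
  translation, and each mixed term pairs two waves travelling in opposite directions, one of them
  of zero average, so it averages to \<open>0\<close>. The averaged Hamiltonian thus splits into one
  energy for \<open>\<xi>\<close> and one for \<open>\<eta>\<close>, each a cubic polynomial along a line of variations, whose linear
  coefficient is the gradient after an integration by parts. The vector field is unique because a
  continuous periodic function orthogonal to all variations does not depend on \<open>y\<^sub>1\<close>; this is
  tested with translates of \<open>(1 + cos \<pi>y\<^sub>1)\<^sup>n (1 + cos \<pi>y\<^sub>2)\<^sup>m\<close>, which are smooth and hence
  admissible for every regularity \<open>r\<close>.\<close>

section \<open>Continuous periodic functions of one variable\<close>

text \<open>The increment \<open>G (x + 2) - G x\<close> has derivative
  \<open>f (x + 2) - f x = 0\<close>, so it is constant, and at \<open>x = -1\<close> it is the
  integral over one period. A zero average therefore makes \<open>G\<close> itself periodic.\<close>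

lemma periodic_antiderivative:
  fixes f :: "real \<Rightarrow> real"
  assumes f: "continuous_on UNIV f" and per: "\<And>x. f (x + 2) = f x"
  obtains G where "\<And>x. (G has_real_derivative f x) (at x)"
    and "\<And>x. G (x + 2) = G x + integral {-1..1} f"
proof -
  \<comment> \<open>The unbounded interval provides a single antiderivative on the whole line, so
    that it can be shifted by 2 freely.\<close>
  have "\<exists>G. \<forall>x::real. -\<infinity> < ereal x \<longrightarrow> ereal x < \<infinity> \<longrightarrow> (G has_vector_derivative f x) (at x)"
    using f by (intro einterval_antiderivative) (auto simp: continuous_on_eq_continuous_at)
  then obtain G where G: "\<And>x. (G has_real_derivative f x) (at x)"
    by (auto simp: has_real_derivative_iff_has_vector_derivative)
  have shift: "((\<lambda>x. G (x + 2)) has_real_derivative f x) (at x)" for x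
    using G[of "x + 2"] by (simp add: DERIV_shift per)
  have "((\<lambda>x. G (x + 2) - G x) has_real_derivative 0) (at x)" for x
    using DERIV_diff[OF shift[of x] G[of x]] by simp
  then have "G (x + 2) - G x = G 1 - G (-1)" for x
    using DERIV_isconst_all[of "\<lambda>x. G (x + 2) - G x" x "-1"] by simp
  moreover have "(f has_integral (G 1 - G (-1))) {-1..1}"
    by (rule fundamental_theorem_of_calculus)
      (auto intro: G has_field_derivative_at_within
        simp flip: has_real_derivative_iff_has_vector_derivative)
  ultimately show ?thesis
    using that[OF G] by (metis integral_unique add.commute diff_eq_eq)
qed

text \<open>Over a window of length 2 the antiderivative gains the same amount wherever the window
  starts.\<close>

lemma integral_periodic_shift:
  fixes f :: "real \<Rightarrow> real"
  assumes f: "continuous_on UNIV f" and per: "\<And>x. f (x + 2) = f x"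
  shows "integral {-1..1} (\<lambda>x. f (x + c)) = integral {-1..1} f"
proof -
  obtain G where G: "\<And>x. (G has_real_derivative f x) (at x)"
    and G2: "\<And>x. G (x + 2) = G x + integral {-1..1} f"
    using periodic_antiderivative[OF assms] by blast
  have "((\<lambda>x. f (x + c)) has_integral (G (1 + c) - G (-1 + c))) {-1..1}"
  proof (rule fundamental_theorem_of_calculus)
    have "((\<lambda>x. G (x + c)) has_real_derivative f (x + c)) (at x)" for x
      using G[of "x + c"] by (simp add: DERIV_shift)
    then show "((\<lambda>x. G (x + c)) has_vector_derivative f (x + c)) (at x within {-1..1})" for x
      by (simp add: has_field_derivative_at_within
          flip: has_real_derivative_iff_has_vector_derivative)
  qed simp
  moreover have "G (1 + c) - G (-1 + c) = integral {-1..1} f"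
    using G2[of "-1 + c"] by (simp add: algebra_simps)
  ultimately show ?thesis
    by (metis integral_unique)
qed

text \<open>The argument sweeps two full periods, in the direction given by the sign
  \<open>s\<close>. The speed \<open>2 * s\<close> is the relative speed of two waves that move in
  opposite directions with speed 1.\<close>

lemma integral_zero_avg_two_periods:
  fixes f :: "real \<Rightarrow> real"
  assumes f: "continuous_on UNIV f" and per: "\<And>x. f (x + 2) = f x"
    and avg: "integral {-1..1} f = 0" and s: "s = 1 \<or> s = -1"
  shows "integral {0..2} (\<lambda>t. f (c + 2 * s * t)) = 0"
proof -
  obtain G where G: "\<And>x. (G has_real_derivative f x) (at x)"
    and G2: "\<And>x. G (x + 2) = G x"
    using periodic_antiderivative[OF f per] avg by auto
  have s0: "s \<noteq> 0"
    using s by auto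
  have "((\<lambda>t. f (c + 2 * s * t)) has_integral
      (G (c + 2 * s * 2) / (2 * s) - G (c + 2 * s * 0) / (2 * s))) {0..2}"
  proof (rule fundamental_theorem_of_calculus)
    have "((\<lambda>t. G (c + 2 * s * t) / (2 * s)) has_real_derivative f (c + 2 * s * t)) (at t)" for t
      using s0 by (auto intro!: derivative_eq_intros DERIV_chain2[OF G])
    then show "((\<lambda>t. G (c + 2 * s * t) / (2 * s)) has_vector_derivative f (c + 2 * s * t))
        (at t within {0..2})" for t
      by (simp add: has_field_derivative_at_within
          flip: has_real_derivative_iff_has_vector_derivative)
  qed simp
  moreover have "G (c + 2 * s * 2) = G c"
    using s
  proof
    assume "s = 1"
    then show ?thesis
      using G2[of c] G2[of "c + 2"] by (simp add: add.commute[of c])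
  next
    assume "s = -1"
    then show ?thesis
      using G2[of "c - 2"] G2[of "c - 4"] by simp
  qed
  ultimately show ?thesis
    by (simp add: integral_unique)
qed

text \<open>The functions \<open>(1 + cos \<pi>s)\<^sup>n\<close> concentrate at \<open>0\<close>: after division by \<open>\<theta>\<^sup>n\<close>, with \<open>\<theta>\<close> the
  value of \<open>1 + cos \<pi>s\<close> at the edge of a neighbourhood of \<open>0\<close>, they are bounded outside of the
  neighbourhood and grow exponentially near its centre.\<close>

lemma orthogonal_cos_powers_nonpos:
  fixes f :: "real \<Rightarrow> real"
  assumes f: "continuous_on {-1..1} f"
    and orth: "\<And>n. integral {-1..1} (\<lambda>s. f s * (1 + cos (pi * s)) ^ n) = 0"
  shows "f 0 \<le> 0"
proof (rule ccontr)
  assume "\<not> f 0 \<le> 0"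
  define c where "c = f 0 / 2"
  have c: "c > 0"
    using \<open>\<not> f 0 \<le> 0\<close> by (simp add: c_def)
  obtain d where d: "d > 0" "\<And>s. s \<in> {-1..1} \<Longrightarrow> dist s 0 < d \<Longrightarrow> dist (f s) (f 0) < c"
    using f c unfolding continuous_on_iff by (metis atLeastAtMost_iff neg_le_0_iff_le zero_le_one)
  \<comment> \<open>Halving puts the closed \<open>\<delta>\<close>-neighbourhood inside the open
    \<open>d\<close>-ball. As \<open>\<delta> < 1\<close>, \<open>pi * \<delta>\<close> stays below
    \<open>pi\<close>, so cosine decreases strictly up to there and \<open>\<theta>\<close> is
    positive.\<close>
  define \<delta> where "\<delta> = min d 1 / 2"
  have \<delta>: "0 < \<delta>" "\<delta> < 1"
    using d by (auto simp: \<delta>_def)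
  have near: "c \<le> f s" if "\<bar>s\<bar> \<le> \<delta>" for s
  proof -
    have "dist (f s) (f 0) < c"
      using that d(1) by (intro d(2)) (auto simp: \<delta>_def dist_real_def abs_if split: if_splits)
    then show ?thesis
      unfolding c_def dist_real_def abs_less_iff by linarith
  qed
  obtain M where M: "\<And>s. s \<in> {-1..1} \<Longrightarrow> \<bar>f s\<bar> \<le> M" "M \<ge> 0"
  proof -
    have "bounded (f ` {-1..1})"
      by (intro compact_imp_bounded compact_continuous_image f) auto
    then obtain M where "\<forall>s\<in>{-1..1}. norm (f s) \<le> M"
      by (auto simp: bounded_iff)
    then show ?thesis
      using that[of M] by (force intro: order_trans[OF abs_ge_zero])
  qed
  define \<theta> where "\<theta> = 1 + cos (pi * \<delta>)"
  \<comment> \<open>The normalised weight at \<open>\<delta> / 2\<close>; exceeding 1, it drives the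
    exponential growth.\<close>
  define q where "q = (1 + cos (pi * (\<delta> / 2))) / \<theta>"
  have \<theta>: "\<theta> > 0"
    using cos_monotone_0_pi[of "pi * \<delta>" pi] \<delta> by (simp add: \<theta>_def)
  have "cos (pi * \<delta>) < cos (pi * (\<delta> / 2))"
    using \<delta> by (intro cos_monotone_0_pi) auto
  then have q: "q > 1"
    using \<theta> by (simp add: q_def \<theta>_def)
  define w where "w s = (1 + cos (pi * s)) / \<theta>" for s
  have abs_cos: "cos (pi * \<bar>s\<bar>) = cos (pi * s)" for s
    by (simp add: abs_if)
  have w0: "0 \<le> w s" for s
    unfolding w_def using \<theta> cos_ge_minus_one[of "pi * s"]
    by (intro divide_nonneg_pos) linarith+
  have w1: "w s \<le> 1" if "\<delta> \<le> \<bar>s\<bar>" "\<bar>s\<bar> \<le> 1" for s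
    using that \<delta> \<theta> cos_monotone_0_pi_le[of "pi * \<delta>" "pi * \<bar>s\<bar>"]
    by (simp add: w_def \<theta>_def abs_cos)
  have wq: "q \<le> w s" if "\<bar>s\<bar> \<le> \<delta> / 2" for s
  proof -
    have "pi * \<bar>s\<bar> \<le> pi * (\<delta> / 2)" "pi * (\<delta> / 2) \<le> pi"
      using that \<delta> by (auto simp: mult_le_cancel_left)
    then have "cos (pi * (\<delta> / 2)) \<le> cos (pi * s)"
      using cos_monotone_0_pi_le[of "pi * \<bar>s\<bar>" "pi * (\<delta> / 2)"] by (simp add: abs_cos)
    then show ?thesis
      using \<theta> by (simp add: w_def q_def divide_right_mono)
  qed
  have bound: "c * q ^ n * \<delta> - 2 * M \<le> 0" for n
  proof -
    \<comment> \<open>A step function below \<open>f s * w s ^ n\<close>: the bump of height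
      \<open>c * q ^ n\<close> has width \<open>\<delta>\<close>, and \<open>- M\<close> covers the
      points where \<open>f\<close> may be negative. Subtracting \<open>M\<close> on all of
      \<open>{-1..1}\<close> costs \<open>2 * M\<close>.\<close>
    let ?g = "\<lambda>s. - M + (if s \<in> {-\<delta>/2..\<delta>/2} then c * q ^ n else 0)"
    have g: "(?g has_integral (2 * (- M) + \<delta> * (c * q ^ n))) {-1..1}"
    proof (rule has_integral_add)
      show "((\<lambda>s::real. - M) has_integral (2 * (- M))) {-1..1}"
        using has_integral_const_real[of "- M" "-1" 1] by simp
      show "((\<lambda>s. if s \<in> {-\<delta>/2..\<delta>/2} then c * q ^ n else 0) has_integral \<delta> * (c * q ^ n)) {-1..1}"
        using has_integral_const_real[of "c * q ^ n" "-\<delta>/2" "\<delta>/2"] \<delta>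
        by (subst has_integral_restrict) auto
    qed
    have "(\<lambda>s. f s * (1 + cos (pi * s)) ^ n) integrable_on {-1..1}"
      by (intro integrable_continuous_real continuous_intros f)
    then have "((\<lambda>s. f s * (1 + cos (pi * s)) ^ n) has_integral 0) {-1..1}"
      using orth[of n] by (metis integrable_integral)
    from has_integral_divide[OF this, of "\<theta> ^ n"]
    have "((\<lambda>s. f s * w s ^ n) has_integral 0) {-1..1}"
      by (simp add: w_def power_divide)
    with g have "2 * (- M) + \<delta> * (c * q ^ n) \<le> 0"
    proof (rule has_integral_le)
      fix s :: real
      assume s: "s \<in> {-1..1}"
      consider "\<bar>s\<bar> \<le> \<delta> / 2" | "\<delta> / 2 < \<bar>s\<bar>" "\<bar>s\<bar> \<le> \<delta>" | "\<delta> < \<bar>s\<bar>"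
        by linarith
      then show "?g s \<le> f s * w s ^ n"
      proof cases
        case 1
        then have "c * q ^ n \<le> f s * w s ^ n"
          using q c w0[of s] near[of s] wq[of s] \<delta> by (intro mult_mono power_mono) auto
        then show ?thesis
          using M(2) 1 by auto
      next
        case 2
        then have "0 \<le> f s * w s ^ n"
          using near[of s] c w0[of s] by simp
        then show ?thesis
          using M(2) 2 by auto
      next
        case 3
        then have "w s ^ n \<le> 1"
          using w0 w1[of s] s by (intro power_le_one) auto
        then have "\<bar>f s * w s ^ n\<bar> \<le> M * 1"
          unfolding abs_mult using M s w0[of s] by (intro mult_mono) auto
        then show ?thesis
          using 3 \<delta> by auto
      qed
    qed
    then show ?thesis
      by (simp add: algebra_simps)
  qed
  obtain n where n: "2 * M / (c * \<delta>) < q ^ n"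
    using real_arch_pow[OF q] by blast
  then show False
    using bound[of n] c \<delta> by (simp add: field_simps)
qed

lemma orthogonal_cos_powers_zero:
  fixes f :: "real \<Rightarrow> real"
  assumes f: "continuous_on {-1..1} f"
    and orth: "\<And>n. integral {-1..1} (\<lambda>s. f s * (1 + cos (pi * s)) ^ n) = 0"
  shows "f 0 = 0"
proof -
  have "- f 0 \<le> 0"
    using orthogonal_cos_powers_nonpos[of "\<lambda>s. - f s"] assms by (simp add: continuous_on_minus)
  then show ?thesis
    using orthogonal_cos_powers_nonpos[OF assms] by simp
qed

section \<open>Integration over the square\<close>

lemma sq_cbox: "sq = cbox (-1, -1) (1, 1)"
  by (auto simp: sq_def cbox_Pair_eq)

lemma continuous_on_UNIV_compose:
  "continuous_on UNIV u \<Longrightarrow> continuous_on A f \<Longrightarrow> continuous_on A (\<lambda>x. u (f x))"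
  by (rule continuous_on_compose2) auto

lemma integrable_sq:
  fixes f :: field
  shows "continuous_on UNIV f \<Longrightarrow> f integrable_on sq"
  unfolding sq_cbox by (intro integrable_continuous) (rule continuous_on_subset, auto)

text \<open>Shifts and zero averages act in \<open>y1\<close> at fixed \<open>y2\<close>, so
  \<open>y1\<close> is made the inner variable by an extra exchange of integrals.\<close>

lemma integral_sq_iterated:
  fixes f :: field
  assumes f: "continuous_on UNIV f"
  shows "integral sq f = integral {-1..1} (\<lambda>y2. integral {-1..1} (\<lambda>y1. f (y1, y2)))"
proof -
  have "integral sq f = integral (cbox (-1) 1) (\<lambda>y1. integral (cbox (-1) 1) (\<lambda>y2. f (y1, y2)))"
    unfolding sq_cbox by (intro integral_prod_continuous continuous_on_subset[OF f]) auto
  also have "\<dots> = integral (cbox (-1) 1) (\<lambda>y2. integral (cbox (-1) 1) (\<lambda>y1. f (y1, y2)))"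
    by (intro integral_swap_continuous) (auto intro: continuous_on_subset[OF f])
  finally show ?thesis
    by simp
qed

lemma continuous_on_slice:
  fixes f :: field
  assumes "continuous_on UNIV f"
  shows "continuous_on A (\<lambda>s. f (s, y2))"
  by (intro continuous_on_UNIV_compose[OF assms] continuous_intros)

text \<open>This serves twice: it makes the unmixed terms constant along the flow, and it allows a
  moving frame for the mixed ones.\<close>

lemma integral_sq_shift:
  fixes f :: field
  assumes f: "continuous_on UNIV f" and per: "periodic2 f"
  shows "integral sq (\<lambda>y. f (fst y + c, snd y)) = integral sq f"
proof -
  have shift: "integral {-1..1} (\<lambda>y1. f (y1 + c, y2)) = integral {-1..1} (\<lambda>y1. f (y1, y2))" for y2
    by (rule integral_periodic_shift) (use per in \<open>auto simp: periodic2_def continuous_on_slice[OF f]\<close>)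
  have "continuous_on UNIV (\<lambda>y. f (fst y + c, snd y))"
    by (intro continuous_on_UNIV_compose[OF f] continuous_intros)
  then have "integral sq (\<lambda>y. f (fst y + c, snd y))
      = integral {-1..1} (\<lambda>y2. integral {-1..1} (\<lambda>y1. f (y1 + c, y2)))"
    by (subst integral_sq_iterated) simp_all
  then show ?thesis
    by (simp add: shift integral_sq_iterated[OF f])
qed

text \<open>Two waves travelling in opposite directions meet with every phase shift during one period, so
  that their product averages to \<open>0\<close> if one of them has zero average.\<close>

lemma opposite_waves_average:
  fixes P Q :: field
  assumes P: "continuous_on UNIV P" "periodic2 P"
    and Q: "continuous_on UNIV Q" "periodic2 Q" "zero_avg1 Q"
    and s: "s = 1 \<or> s = -1"
  shows "((\<lambda>t. integral sq (\<lambda>y. P (fst y - s * t, snd y) * Q (fst y + s * t, snd y)))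
    has_integral 0) {0..2}"
proof -
  \<comment> \<open>In the frame moving with \<open>P\<close>, only \<open>Q\<close> depends on
    time, at twice the speed.\<close>
  define R where "R t y = P y * Q (fst y + 2 * s * t, snd y)" for t :: real and y :: "real \<times> real"
  have R: "continuous_on A (\<lambda>(t, y). R t y)" for A
    unfolding R_def case_prod_beta'
    by (intro continuous_intros continuous_on_UNIV_compose[OF P(1)] continuous_on_UNIV_compose[OF Q(1)])
  have "continuous_on {0..2} (\<lambda>t. integral sq (R t))"
    unfolding sq_cbox by (intro integral_continuous_on_param R)
  then have "((\<lambda>t. integral sq (R t)) has_integral integral {0..2} (\<lambda>t. integral sq (R t))) {0..2}"
    by (intro integrable_integral integrable_continuous_real)
  \<comment> \<open>After the exchange, each point \<open>y\<close> carries only a time integral of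
    \<open>Q\<close> over two periods.\<close>
  also have "integral {0..2} (\<lambda>t. integral sq (R t)) = integral sq (\<lambda>y. integral {0..2} (\<lambda>t. R t y))"
    using integral_swap_continuous[of 0 "(-1, -1)" 2 "(1, 1)" R, OF R] by (simp add: sq_cbox)
  also have "(\<lambda>y. integral {0..2} (\<lambda>t. R t y)) = (\<lambda>y. 0)"
  proof
    fix y :: "real \<times> real"
    have "integral {0..2} (\<lambda>t. Q (fst y + 2 * s * t, snd y)) = 0"
      by (rule integral_zero_avg_two_periods[where f = "\<lambda>x. Q (x, snd y)"])
        (use Q s in \<open>auto simp: periodic2_def zero_avg1_def continuous_on_slice[OF Q(1)]\<close>)
    then show "integral {0..2} (\<lambda>t. R t y) = 0"
      by (simp add: R_def)
  qed
  finally have "((\<lambda>t. integral sq (R t)) has_integral 0) {0..2}"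
    by simp
  moreover have "integral sq (R t)
      = integral sq (\<lambda>y. P (fst y - s * t, snd y) * Q (fst y + s * t, snd y))" for t
  proof -
    have "continuous_on UNIV (\<lambda>y. P (fst y - s * t, snd y) * Q (fst y + s * t, snd y))"
      by (intro continuous_intros continuous_on_UNIV_compose[OF P(1)] continuous_on_UNIV_compose[OF Q(1)])
    moreover have "periodic2 (\<lambda>y. P (fst y - s * t, snd y) * Q (fst y + s * t, snd y))"
    proof -
      have "P (x + 2 - s * t, z) = P (x - s * t, z)" "Q (x + 2 + s * t, z) = Q (x + s * t, z)" for x z
        using P(2) Q(2) unfolding periodic2_def by (metis add_diff_eq add.commute diff_add_eq add.assoc)+
      then show ?thesis
        using P(2) Q(2) by (simp add: periodic2_def)
    qed
    ultimately have "integral sq (\<lambda>y. P (fst y + s * t - s * t, snd y) * Q (fst y + s * t + s * t, snd y))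
        = integral sq (\<lambda>y. P (fst y - s * t, snd y) * Q (fst y + s * t, snd y))"
      using integral_sq_shift[of "\<lambda>y. P (fst y - s * t, snd y) * Q (fst y + s * t, snd y)" "s * t"]
      by (simp only: fst_conv snd_conv)
    moreover have "R t = (\<lambda>y. P (fst y + s * t - s * t, snd y) * Q (fst y + s * t + s * t, snd y))"
      by (simp add: R_def fun_eq_iff algebra_simps)
    ultimately show ?thesis
      by simp
  qed
  ultimately show ?thesis
    by simp
qed

section \<open>Differentiation in the first variable\<close>

lemma has_pd1_DERIV:
  "has_pd1 u \<Longrightarrow> ((\<lambda>s. u (s, y2)) has_real_derivative \<partial>\<^sub>1 u (y1, y2)) (at y1)"
  by (auto simp: has_pd1_def pd1_def DERIV_deriv_iff_real_differentiable)

lemma pd1_eqI: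
  "((\<lambda>s. u (s, snd y)) has_real_derivative D) (at (fst y)) \<Longrightarrow> \<partial>\<^sub>1 u y = D"
  by (auto simp: pd1_def case_prod_beta intro: DERIV_imp_deriv)

lemma has_pd1I:
  "(\<And>y1 y2. ((\<lambda>s. u (s, y2)) has_real_derivative D y1 y2) (at y1)) \<Longrightarrow> has_pd1 u"
  unfolding has_pd1_def by (auto simp: real_differentiable_def)

lemma has_pd2_DERIV:
  "has_pd2 u \<Longrightarrow> ((\<lambda>s. u (y1, s)) has_real_derivative \<partial>\<^sub>2 u (y1, y2)) (at y2)"
  by (auto simp: has_pd2_def pd2_def DERIV_deriv_iff_real_differentiable)

lemma pd2_eqI:
  "((\<lambda>s. u (fst y, s)) has_real_derivative D) (at (snd y)) \<Longrightarrow> \<partial>\<^sub>2 u y = D"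
  by (auto simp: pd2_def case_prod_beta intro: DERIV_imp_deriv)

lemma has_pd2I:
  "(\<And>y1 y2. ((\<lambda>s. u (y1, s)) has_real_derivative D y1 y2) (at y2)) \<Longrightarrow> has_pd2 u"
  unfolding has_pd2_def by (auto simp: real_differentiable_def)

lemma pd1_add_scaled:
  assumes "has_pd1 u" "has_pd1 v"
  shows "has_pd1 (\<lambda>y. u y + c * v y)"
    and "\<partial>\<^sub>1 (\<lambda>y. u y + c * v y) = (\<lambda>y. \<partial>\<^sub>1 u y + c * \<partial>\<^sub>1 v y)"
proof -
  have "((\<lambda>s. u (s, y2) + c * v (s, y2)) has_real_derivative
      \<partial>\<^sub>1 u (y1, y2) + c * \<partial>\<^sub>1 v (y1, y2)) (at y1)" for y1 y2
    by (intro DERIV_add DERIV_cmult has_pd1_DERIV assms)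
  then show "has_pd1 (\<lambda>y. u y + c * v y)"
    and "\<partial>\<^sub>1 (\<lambda>y. u y + c * v y) = (\<lambda>y. \<partial>\<^sub>1 u y + c * \<partial>\<^sub>1 v y)"
    by (auto intro!: has_pd1I pd1_eqI)
qed

lemma pd2_add_scaled:
  assumes "has_pd2 u" "has_pd2 v"
  shows "has_pd2 (\<lambda>y. u y + c * v y)"
    and "\<partial>\<^sub>2 (\<lambda>y. u y + c * v y) = (\<lambda>y. \<partial>\<^sub>2 u y + c * \<partial>\<^sub>2 v y)"
proof -
  have "((\<lambda>s. u (y1, s) + c * v (y1, s)) has_real_derivative
      \<partial>\<^sub>2 u (y1, y2) + c * \<partial>\<^sub>2 v (y1, y2)) (at y2)" for y1 y2
    by (intro DERIV_add DERIV_cmult has_pd2_DERIV assms)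
  then show "has_pd2 (\<lambda>y. u y + c * v y)"
    and "\<partial>\<^sub>2 (\<lambda>y. u y + c * v y) = (\<lambda>y. \<partial>\<^sub>2 u y + c * \<partial>\<^sub>2 v y)"
    by (auto intro!: has_pd2I pd2_eqI)
qed

lemma periodic2_pd1:
  assumes "has_pd1 u" "periodic2 u"
  shows "periodic2 (\<partial>\<^sub>1 u)"
proof -
  have per: "u (x + 2, z) = u (x, z)" "u (x, z + 2) = u (x, z)" for x z
    using assms(2) by (auto simp: periodic2_def)
  have "((\<lambda>s. u (s, z)) has_real_derivative \<partial>\<^sub>1 u (x + 2, z)) (at x)" for x z
    using has_pd1_DERIV[OF assms(1), of z "x + 2"] by (simp add: DERIV_shift per)
  then have "\<partial>\<^sub>1 u (x + 2, z) = \<partial>\<^sub>1 u (x, z)" for x z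
    by (metis pd1_eqI fst_conv snd_conv)
  moreover have "\<partial>\<^sub>1 u (x, z + 2) = \<partial>\<^sub>1 u (x, z)" for x z
    by (simp add: pd1_def per)
  ultimately show ?thesis
    by (simp add: periodic2_def)
qed

text \<open>The integral is the increment of \<open>u\<close> over one period. Derivatives of fields
  thus count as zero-average waves, and integration by parts has no boundary term.\<close>

lemma zero_avg1_pd1:
  assumes "has_pd1 u" "periodic2 u"
  shows "zero_avg1 (\<partial>\<^sub>1 u)"
  unfolding zero_avg1_def
proof
  fix z
  have "((\<lambda>s. \<partial>\<^sub>1 u (s, z)) has_integral (u (1, z) - u (-1, z))) {-1..1}"
    by (rule fundamental_theorem_of_calculus)
      (auto intro: has_pd1_DERIV[OF assms(1)] has_field_derivative_at_within
        simp flip: has_real_derivative_iff_has_vector_derivative)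
  moreover have "u (-1 + 2, z) = u (-1, z)"
    using assms(2) by (simp only: periodic2_def)
  ultimately show "integral {-1..1} (\<lambda>s. \<partial>\<^sub>1 u (s, z)) = 0"
    by (simp add: integral_unique)
qed

lemma integral_sq_by_parts:
  assumes u: "continuous_on UNIV u" "has_pd1 u" "continuous_on UNIV (\<partial>\<^sub>1 u)" "periodic2 u"
    and v: "continuous_on UNIV v" "has_pd1 v" "continuous_on UNIV (\<partial>\<^sub>1 v)" "periodic2 v"
  shows "integral sq (\<lambda>y. u y * \<partial>\<^sub>1 v y) = - integral sq (\<lambda>y. \<partial>\<^sub>1 u y * v y)"
proof -
  let ?w = "\<lambda>y. u y * v y"
  have D: "((\<lambda>s. ?w (s, y2)) has_real_derivative
      u (y1, y2) * \<partial>\<^sub>1 v (y1, y2) + \<partial>\<^sub>1 u (y1, y2) * v (y1, y2)) (at y1)" for y1 y2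
    using DERIV_mult[OF has_pd1_DERIV[OF u(2)] has_pd1_DERIV[OF v(2)]] by (simp add: algebra_simps)
  then have w: "has_pd1 ?w"
    by (rule has_pd1I)
  have w': "\<partial>\<^sub>1 ?w = (\<lambda>y. u y * \<partial>\<^sub>1 v y + \<partial>\<^sub>1 u y * v y)"
    using D by (auto intro!: pd1_eqI)
  have "zero_avg1 (\<partial>\<^sub>1 ?w)"
    using u(4) v(4) by (intro zero_avg1_pd1 w) (simp add: periodic2_def)
  moreover have "continuous_on UNIV (\<partial>\<^sub>1 ?w)"
    unfolding w' by (intro continuous_intros u v)
  ultimately have "integral sq (\<partial>\<^sub>1 ?w) = 0"
    by (subst integral_sq_iterated) (auto simp: zero_avg1_def)
  then show ?thesis
    unfolding w' by (subst (asm) integral_add) (auto intro!: integrable_sq continuous_intros u v)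
qed

section \<open>Spaces of fields\<close>

lemma C_k_add_scaled:
  "C_k k u \<Longrightarrow> C_k k v \<Longrightarrow> C_k k (\<lambda>y. u y + c * v y)"
proof (induction k arbitrary: u v)
  case 0
  then show ?case
    by (auto intro!: continuous_intros)
next
  case (Suc k)
  then show ?case
    by (auto intro!: continuous_intros simp: pd1_add_scaled pd2_add_scaled)
qed

lemma zero_avg1_add_scaled:
  assumes "zero_avg1 u" "zero_avg1 v" "continuous_on UNIV u" "continuous_on UNIV v"
  shows "zero_avg1 (\<lambda>y. u y + c * v y)"
  unfolding zero_avg1_def
proof
  fix z
  have "integral {-1..1} (\<lambda>s. u (s, z) + c * v (s, z))
      = integral {-1..1} (\<lambda>s. u (s, z)) + integral {-1..1} (\<lambda>s. c * v (s, z))"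
    by (intro integral_add integrable_continuous_real continuous_intros continuous_on_slice assms)
  then show "integral {-1..1} (\<lambda>s. u (s, z) + c * v (s, z)) = 0"
    using assms by (simp add: zero_avg1_def)
qed

text \<open>Varied fields must stay in the space, since the split form of the averaged Hamiltonian
  is established only there.\<close>

lemma fields_add_scaled:
  assumes "u \<in> fields r" "v \<in> fields r"
  shows "(\<lambda>y. u y + c * v y) \<in> fields r"
proof -
  \<comment> \<open>\<open>enat 0 \<le> r\<close> always holds, so continuity is available at every
    regularity.\<close>
  have "C_k 0 u" "C_k 0 v"
    using assms by (auto simp: fields_def simp flip: zero_enat_def simp del: C_k.simps)
  then show ?thesis
    using assms by (auto simp: fields_def periodic2_def C_k_add_scaled zero_avg1_add_scaled)
qed

text \<open>Regularity 3 matches the equations: the gradient contains a second derivative, and the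
  Poisson tensor takes one more.\<close>

lemma fields_regular:
  assumes u: "u \<in> fields r" and r: "3 \<le> r"
  shows "continuous_on UNIV u" "has_pd1 u" "continuous_on UNIV (\<partial>\<^sub>1 u)" "has_pd1 (\<partial>\<^sub>1 u)"
    "continuous_on UNIV (\<partial>\<^sub>1 (\<partial>\<^sub>1 u))" "has_pd1 (\<partial>\<^sub>1 (\<partial>\<^sub>1 u))"
    "periodic2 u" "zero_avg1 u" "periodic2 (\<partial>\<^sub>1 u)" "zero_avg1 (\<partial>\<^sub>1 u)"
proof -
  have "C_k 3 u"
    using assms by (simp add: fields_def numeral_eq_enat)
  then show *: "continuous_on UNIV u" "has_pd1 u" "continuous_on UNIV (\<partial>\<^sub>1 u)" "has_pd1 (\<partial>\<^sub>1 u)"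
    "continuous_on UNIV (\<partial>\<^sub>1 (\<partial>\<^sub>1 u))" "has_pd1 (\<partial>\<^sub>1 (\<partial>\<^sub>1 u))"
    by (auto simp: numeral_3_eq_3)
  show **: "periodic2 u" "zero_avg1 u"
    using u by (auto simp: fields_def)
  show "periodic2 (\<partial>\<^sub>1 u)" "zero_avg1 (\<partial>\<^sub>1 u)"
    using * ** by (auto intro: periodic2_pd1 zero_avg1_pd1)
qed

section \<open>The averaged Hamiltonian\<close>

text \<open>The KdV Hamiltonian of a single field. It serves both fields, because the sign in
  \<open>\<xi> - \<eta>\<close> survives only in the mixed term.\<close>

definition kdv_energy :: "real \<Rightarrow> real \<Rightarrow> field \<Rightarrow> real" where
  "kdv_energy \<alpha> \<mu> u = integral sq (\<lambda>y. (u y)\<^sup>2 / 2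
     + \<mu>\<^sup>2 * (- (\<partial>\<^sub>1 u y)\<^sup>2 / 48 + \<alpha> * (u y) ^ 3 / (3 * 2 powr (3 / 2))))"

text \<open>One representative of the gradient of \<open>kdv_energy\<close>, among those differing
  by functions of \<open>y2\<close>.\<close>

definition kdv_grad :: "real \<Rightarrow> real \<Rightarrow> field \<Rightarrow> field" where
  "kdv_grad \<alpha> \<mu> u = (\<lambda>y. u y
     + \<mu>\<^sup>2 * (\<partial>\<^sub>1 (\<partial>\<^sub>1 u) y / 24 + \<alpha> * (u y)\<^sup>2 / 2 powr (3 / 2)))"

section \<open>Averaging along the flow\<close>

lemma pd1_flow_h0:
  assumes "has_pd1 \<xi>" "has_pd1 \<eta>"
  shows "\<partial>\<^sub>1 (\<lambda>z. \<xi> (fst z - \<tau>, snd z) - \<eta> (fst z + \<tau>, snd z)) y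
    = \<partial>\<^sub>1 \<xi> (fst y - \<tau>, snd y) - \<partial>\<^sub>1 \<eta> (fst y + \<tau>, snd y)"
proof (rule pd1_eqI)
  have "((\<lambda>s. \<xi> (s + - \<tau>, snd y)) has_real_derivative \<partial>\<^sub>1 \<xi> (fst y + - \<tau>, snd y)) (at (fst y))"
    "((\<lambda>s. \<eta> (s + \<tau>, snd y)) has_real_derivative \<partial>\<^sub>1 \<eta> (fst y + \<tau>, snd y)) (at (fst y))"
    using has_pd1_DERIV[OF assms(1), of "snd y" "fst y + - \<tau>"]
      has_pd1_DERIV[OF assms(2), of "snd y" "fst y + \<tau>"]
    by (simp_all only: DERIV_shift)
  from DERIV_diff[OF this]
  show "((\<lambda>s. \<xi> (fst (s, snd y) - \<tau>, snd (s, snd y)) - \<eta> (fst (s, snd y) + \<tau>, snd (s, snd y)))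
      has_real_derivative \<partial>\<^sub>1 \<xi> (fst y - \<tau>, snd y) - \<partial>\<^sub>1 \<eta> (fst y + \<tau>, snd y)) (at (fst y))"
    by simp
qed

lemma flow_avg_F2:
  fixes \<alpha> :: real
  assumes \<xi>: "\<xi> \<in> fields r" and \<eta>: "\<eta> \<in> fields r" and r: "3 \<le> r"
  defines "W \<equiv> \<lambda>u :: field. integral sq (\<lambda>y. - (\<partial>\<^sub>1 u y)\<^sup>2 / 48 + \<alpha> * (u y) ^ 3 / (3 * 2 powr (3 / 2)))"
  shows "flow_avg (F2 \<alpha>) (\<xi>, \<eta>) = W \<xi> + W \<eta>"
proof -
  note reg = fields_regular[OF \<xi> r] fields_regular[OF \<eta> r]
  define \<gamma> where "\<gamma> = \<alpha> / 2 powr (3 / 2)"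
  define w where "w u y = - (\<partial>\<^sub>1 u y)\<^sup>2 / 48 + \<alpha> * (u y) ^ 3 / (3 * 2 powr (3 / 2))"
    for u :: field and y
  have W_w: "W u = integral sq (w u)" for u
    unfolding W_def w_def by (rule refl)
  \<comment> \<open>A mixed term at time \<open>\<tau>\<close>: \<open>P\<close> travels with
    \<open>\<xi>\<close> and \<open>Q\<close> with \<open>\<eta>\<close>.\<close>
  define X where "X P Q \<tau> = integral sq (\<lambda>y. P (fst y - \<tau>, snd y) * Q (fst y + \<tau>, snd y))"
    for P Q :: field and \<tau> :: real
  have cont_w: "continuous_on UNIV (w \<xi>)" "continuous_on UNIV (w \<eta>)"
    unfolding w_def[abs_def] by (intro continuous_intros reg; simp)+
  have per_w: "periodic2 (w \<xi>)" "periodic2 (w \<eta>)"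
    using reg by (auto simp: w_def periodic2_def)
  have sq2: "continuous_on UNIV (\<lambda>y. (\<xi> y)\<^sup>2)" "periodic2 (\<lambda>y. (\<xi> y)\<^sup>2)"
    "continuous_on UNIV (\<lambda>y. (\<eta> y)\<^sup>2)" "periodic2 (\<lambda>y. (\<eta> y)\<^sup>2)"
    using reg by (auto simp: periodic2_def intro!: continuous_intros)
  \<comment> \<open>Expanding the square and the cube leaves three mixed terms:
    \<open>1 / 24\<close> is the double product over 48, and in \<open>\<gamma>\<close> the binomial
    3 has cancelled the 3 of the denominator.\<close>
  have F2_flow: "F2 \<alpha> (flow_h0 \<tau> (\<xi>, \<eta>)) = (W \<xi> + W \<eta>) + 1 / 24 * X (\<partial>\<^sub>1 \<xi>) (\<partial>\<^sub>1 \<eta>) \<tau>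
      + \<gamma> * X (\<lambda>y. (\<xi> y)\<^sup>2) \<eta> \<tau> + \<gamma> * X \<xi> (\<lambda>y. (\<eta> y)\<^sup>2) \<tau>" for \<tau>
  proof -
    have shift: "continuous_on UNIV (\<lambda>y. u (fst y - \<tau>, snd y))"
      "continuous_on UNIV (\<lambda>y. u (fst y + \<tau>, snd y))" if "continuous_on UNIV u" for u :: field
      by (intro continuous_on_UNIV_compose[OF that] continuous_intros)+
    have int: "(\<lambda>y. w \<xi> (fst y - \<tau>, snd y)) integrable_on sq"
      "(\<lambda>y. w \<eta> (fst y + \<tau>, snd y)) integrable_on sq"
      "(\<lambda>y. \<partial>\<^sub>1 \<xi> (fst y - \<tau>, snd y) * \<partial>\<^sub>1 \<eta> (fst y + \<tau>, snd y)) integrable_on sq"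
      "(\<lambda>y. (\<xi> (fst y - \<tau>, snd y))\<^sup>2 * \<eta> (fst y + \<tau>, snd y)) integrable_on sq"
      "(\<lambda>y. \<xi> (fst y - \<tau>, snd y) * (\<eta> (fst y + \<tau>, snd y))\<^sup>2) integrable_on sq"
      by (intro integrable_sq continuous_intros shift reg cont_w)+
    have "F2 \<alpha> (flow_h0 \<tau> (\<xi>, \<eta>)) = integral sq (\<lambda>y. w \<xi> (fst y - \<tau>, snd y) + w \<eta> (fst y + \<tau>, snd y)
        + 1 / 24 * (\<partial>\<^sub>1 \<xi> (fst y - \<tau>, snd y) * \<partial>\<^sub>1 \<eta> (fst y + \<tau>, snd y))
        + \<gamma> * ((\<xi> (fst y - \<tau>, snd y))\<^sup>2 * \<eta> (fst y + \<tau>, snd y))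
        + \<gamma> * (\<xi> (fst y - \<tau>, snd y) * (\<eta> (fst y + \<tau>, snd y))\<^sup>2))"
      unfolding F2_def flow_h0_def
      by (simp only: case_prod_beta' fst_conv snd_conv pd1_flow_h0[OF reg(2) reg(12)])
        (intro integral_cong,
          simp add: w_def \<gamma>_def field_simps power2_eq_square power3_eq_cube)
    also have "\<dots> = integral sq (\<lambda>y. w \<xi> (fst y - \<tau>, snd y)) + integral sq (\<lambda>y. w \<eta> (fst y + \<tau>, snd y))
        + 1 / 24 * X (\<partial>\<^sub>1 \<xi>) (\<partial>\<^sub>1 \<eta>) \<tau> + \<gamma> * X (\<lambda>y. (\<xi> y)\<^sup>2) \<eta> \<tau> + \<gamma> * X \<xi> (\<lambda>y. (\<eta> y)\<^sup>2) \<tau>"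
      unfolding X_def
      by (simp only: integral_add integral_mult_right integrable_add integrable_on_mult_right int)
    also have "integral sq (\<lambda>y. w \<xi> (fst y - \<tau>, snd y)) = W \<xi>"
      using integral_sq_shift[OF cont_w(1) per_w(1), of "- \<tau>"] by (simp add: W_w)
    also have "integral sq (\<lambda>y. w \<eta> (fst y + \<tau>, snd y)) = W \<eta>"
      using integral_sq_shift[OF cont_w(2) per_w(2), of \<tau>] by (simp add: W_w)
    finally show ?thesis .
  qed
  have X1: "(X (\<partial>\<^sub>1 \<xi>) (\<partial>\<^sub>1 \<eta>) has_integral 0) {0..2}"
    using opposite_waves_average[of "\<partial>\<^sub>1 \<xi>" "\<partial>\<^sub>1 \<eta>" 1] reg by (simp add: X_def[abs_def])
  have X2: "(X (\<lambda>y. (\<xi> y)\<^sup>2) \<eta> has_integral 0) {0..2}"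
    using opposite_waves_average[of "\<lambda>y. (\<xi> y)\<^sup>2" \<eta> 1] reg sq2 by (simp add: X_def[abs_def])
  \<comment> \<open>Here \<open>\<xi>\<close> is the factor of zero average, so it takes the role of
    \<open>Q\<close>, and \<open>s = -1\<close> reverses the directions accordingly.\<close>
  have X3: "(X \<xi> (\<lambda>y. (\<eta> y)\<^sup>2) has_integral 0) {0..2}"
    using opposite_waves_average[of "\<lambda>y. (\<eta> y)\<^sup>2" \<xi> "-1"] reg sq2
    by (simp add: X_def[abs_def] mult.commute)
  \<comment> \<open>The 2 is the period, cancelled by the \<open>1 / 2\<close> in
    \<open>flow_avg\<close>.\<close>
  have "((\<lambda>\<tau>. F2 \<alpha> (flow_h0 \<tau> (\<xi>, \<eta>))) has_integral
      (2 * (W \<xi> + W \<eta>) + 1 / 24 * 0 + \<gamma> * 0 + \<gamma> * 0)) {0..2}"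
    unfolding F2_flow
    by (intro has_integral_add has_integral_mult_right X1 X2 X3)
      (use has_integral_const_real[of "W \<xi> + W \<eta>" 0 2] in simp)
  then show ?thesis
    by (simp add: flow_avg_def integral_unique)
qed

lemma averaged_hamiltonian:
  assumes \<xi>: "\<xi> \<in> fields r" and \<eta>: "\<eta> \<in> fields r" and r: "3 \<le> r"
  shows "h0 (\<xi>, \<eta>) + \<mu>\<^sup>2 * flow_avg (F2 \<alpha>) (\<xi>, \<eta>) = kdv_energy \<alpha> \<mu> \<xi> + kdv_energy \<alpha> \<mu> \<eta>"
proof -
  have int: "(\<lambda>y. (u y)\<^sup>2 / 2) integrable_on sq"
    "(\<lambda>y. - (\<partial>\<^sub>1 u y)\<^sup>2 / 48 + \<alpha> * (u y) ^ 3 / (3 * 2 powr (3 / 2))) integrable_on sq"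
    if "u \<in> fields r" for u
    by (intro integrable_sq continuous_intros fields_regular[OF that r]; simp)+
  have "h0 (\<xi>, \<eta>) = integral sq (\<lambda>y. (\<xi> y)\<^sup>2 / 2) + integral sq (\<lambda>y. (\<eta> y)\<^sup>2 / 2)"
    by (simp add: h0_def add_divide_distrib integral_add int[OF \<xi>] int[OF \<eta>])
  moreover have "kdv_energy \<alpha> \<mu> u = integral sq (\<lambda>y. (u y)\<^sup>2 / 2)
      + \<mu>\<^sup>2 * integral sq (\<lambda>y. - (\<partial>\<^sub>1 u y)\<^sup>2 / 48 + \<alpha> * (u y) ^ 3 / (3 * 2 powr (3 / 2)))"
    if "u \<in> fields r" for u
    unfolding kdv_energy_def
    by (simp only: integral_add integral_mult_right integrable_on_mult_right int[OF that])
  ultimately show ?thesis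
    using \<xi> \<eta> by (simp add: flow_avg_F2[OF assms] distrib_left)
qed

section \<open>The gradient of the energy\<close>

lemma kdv_energy_has_gradient:
  assumes u: "u \<in> fields r" and h: "h \<in> fields r" and r: "3 \<le> r"
  shows "((\<lambda>e. kdv_energy \<alpha> \<mu> (\<lambda>y. u y + e * h y)) has_real_derivative
    integral sq (\<lambda>y. kdv_grad \<alpha> \<mu> u y * h y)) (at 0)"
proof -
  note reg = fields_regular[OF u r] fields_regular[OF h r]
  define \<gamma> where "\<gamma> = \<alpha> / 2 powr (3 / 2)"
  \<comment> \<open>\<open>c0\<close> to \<open>c3\<close> are the coefficients of the powers of
    \<open>e\<close> in the integrand of the varied energy.\<close>
  define c0 where "c0 y = (u y)\<^sup>2 / 2 + \<mu>\<^sup>2 * (- (\<partial>\<^sub>1 u y)\<^sup>2 / 48 + \<gamma> / 3 * (u y) ^ 3)" for y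
  define c1 where "c1 y = (u y * h y + \<mu>\<^sup>2 * (\<gamma> * (u y)\<^sup>2 * h y)) - \<mu>\<^sup>2 / 24 * (\<partial>\<^sub>1 u y * \<partial>\<^sub>1 h y)" for y
  define c2 where "c2 y = (h y)\<^sup>2 / 2 + \<mu>\<^sup>2 * (- (\<partial>\<^sub>1 h y)\<^sup>2 / 48 + \<gamma> * u y * (h y)\<^sup>2)" for y
  define c3 where "c3 y = \<mu>\<^sup>2 * (\<gamma> / 3 * (h y) ^ 3)" for y
  have int: "c0 integrable_on sq" "c1 integrable_on sq" "c2 integrable_on sq" "c3 integrable_on sq"
    unfolding c0_def[abs_def] c1_def[abs_def] c2_def[abs_def] c3_def[abs_def]
    by (intro integrable_sq continuous_intros reg; simp)+
  have "kdv_energy \<alpha> \<mu> (\<lambda>y. u y + e * h y)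
      = integral sq (\<lambda>y. c0 y + e * c1 y + e\<^sup>2 * c2 y + e ^ 3 * c3 y)" for e
    unfolding kdv_energy_def pd1_add_scaled(2)[OF reg(2) reg(12)]
    by (intro integral_cong)
      (simp add: c0_def c1_def c2_def c3_def \<gamma>_def field_simps power2_eq_square power3_eq_cube)
  then have poly: "kdv_energy \<alpha> \<mu> (\<lambda>y. u y + e * h y)
      = integral sq c0 + e * integral sq c1 + e\<^sup>2 * integral sq c2 + e ^ 3 * integral sq c3" for e
    by (simp only: integral_add integral_mult_right integrable_add integrable_on_mult_right int)
  have int': "(\<lambda>y. u y * h y + \<mu>\<^sup>2 * (\<gamma> * (u y)\<^sup>2 * h y)) integrable_on sq"
    "(\<lambda>y. \<partial>\<^sub>1 u y * \<partial>\<^sub>1 h y) integrable_on sq" "(\<lambda>y. \<partial>\<^sub>1 (\<partial>\<^sub>1 u) y * h y) integrable_on sq"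
    by (intro integrable_sq continuous_intros reg; simp)+
  have "integral sq c1 = integral sq (\<lambda>y. u y * h y + \<mu>\<^sup>2 * (\<gamma> * (u y)\<^sup>2 * h y))
      - \<mu>\<^sup>2 / 24 * integral sq (\<lambda>y. \<partial>\<^sub>1 u y * \<partial>\<^sub>1 h y)"
    unfolding c1_def[abs_def]
    by (simp only: integral_diff integral_mult_right integrable_on_mult_right int')
  \<comment> \<open>The derivative moves off the variation \<open>h\<close>; the new minus sign
    cancels the one in \<open>c1\<close>, which makes the dispersive term of \<open>kdv_grad\<close>
    positive.\<close>
  also have "integral sq (\<lambda>y. \<partial>\<^sub>1 u y * \<partial>\<^sub>1 h y) = - integral sq (\<lambda>y. \<partial>\<^sub>1 (\<partial>\<^sub>1 u) y * h y)"
    by (rule integral_sq_by_parts) (rule reg)+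
  also have "integral sq (\<lambda>y. u y * h y + \<mu>\<^sup>2 * (\<gamma> * (u y)\<^sup>2 * h y))
      - \<mu>\<^sup>2 / 24 * - integral sq (\<lambda>y. \<partial>\<^sub>1 (\<partial>\<^sub>1 u) y * h y)
      = integral sq (\<lambda>y. u y * h y + \<mu>\<^sup>2 * (\<gamma> * (u y)\<^sup>2 * h y) + \<mu>\<^sup>2 / 24 * (\<partial>\<^sub>1 (\<partial>\<^sub>1 u) y * h y))"
    by (simp add: integral_add integrable_on_mult_right int')
  also have "\<dots> = integral sq (\<lambda>y. kdv_grad \<alpha> \<mu> u y * h y)"
    by (intro integral_cong) (simp add: kdv_grad_def \<gamma>_def field_simps)
  finally have "integral sq c1 = integral sq (\<lambda>y. kdv_grad \<alpha> \<mu> u y * h y)" .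
  moreover have "((\<lambda>e. integral sq c0 + e * integral sq c1 + e\<^sup>2 * integral sq c2
      + e ^ 3 * integral sq c3) has_real_derivative integral sq c1) (at 0)"
    by (auto intro!: derivative_eq_intros)
  ultimately show ?thesis
    unfolding poly by simp
qed

lemma pd1_kdv_grad:
  assumes u: "u \<in> fields r" and r: "3 \<le> r"
  shows "has_pd1 (kdv_grad \<alpha> \<mu> u)"
    and "\<partial>\<^sub>1 (kdv_grad \<alpha> \<mu> u) y = \<partial>\<^sub>1 u y + \<mu>\<^sup>2 / 24 * (\<partial>\<^sub>1 ^^ 3) u y
      + \<mu>\<^sup>2 * \<alpha> / (2 * sqrt 2) * \<partial>\<^sub>1 (\<lambda>z. (u z)\<^sup>2) y"
proof -
  note reg = fields_regular[OF u r]
  \<comment> \<open>Source of the denominator \<open>2 * sqrt 2\<close>; the 2 from differentiating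
    the square is absorbed again into
    \<open>\<partial>\<^sub>1 (\<lambda>z. (u z)\<^sup>2)\<close>.\<close>
  have powr: "2 powr (3 / 2) = 2 * sqrt (2::real)"
    using powr_add[of "2::real" 1 "1 / 2"] by (simp add: powr_half_sqrt)
  have sq2: "((\<lambda>s. (u (s, y2))\<^sup>2) has_real_derivative 2 * u (y1, y2) * \<partial>\<^sub>1 u (y1, y2)) (at y1)" for y1 y2
    using DERIV_power[OF has_pd1_DERIV[OF reg(2)], where n = 2] by (simp add: ac_simps)
  then have sq2': "\<partial>\<^sub>1 (\<lambda>z. (u z)\<^sup>2) y = 2 * u y * \<partial>\<^sub>1 u y" for y
    by (intro pd1_eqI) (metis prod.collapse)
  have D: "((\<lambda>s. kdv_grad \<alpha> \<mu> u (s, y2)) has_real_derivative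
      \<partial>\<^sub>1 u (y1, y2) + \<mu>\<^sup>2 * (\<partial>\<^sub>1 (\<partial>\<^sub>1 (\<partial>\<^sub>1 u)) (y1, y2) / 24
        + \<alpha> * (2 * u (y1, y2) * \<partial>\<^sub>1 u (y1, y2)) / 2 powr (3 / 2))) (at y1)" for y1 y2
    unfolding kdv_grad_def
    by (intro DERIV_add DERIV_cmult DERIV_cdivide has_pd1_DERIV reg sq2)
  then show "has_pd1 (kdv_grad \<alpha> \<mu> u)"
    by (rule has_pd1I)
  have "\<partial>\<^sub>1 (kdv_grad \<alpha> \<mu> u) y = \<partial>\<^sub>1 u y + \<mu>\<^sup>2 * (\<partial>\<^sub>1 (\<partial>\<^sub>1 (\<partial>\<^sub>1 u)) y / 24
      + \<alpha> * (2 * u y * \<partial>\<^sub>1 u y) / 2 powr (3 / 2))"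
    using D[of "snd y" "fst y"] by (intro pd1_eqI) simp
  then show "\<partial>\<^sub>1 (kdv_grad \<alpha> \<mu> u) y = \<partial>\<^sub>1 u y + \<mu>\<^sup>2 / 24 * (\<partial>\<^sub>1 ^^ 3) u y
      + \<mu>\<^sup>2 * \<alpha> / (2 * sqrt 2) * \<partial>\<^sub>1 (\<lambda>z. (u z)\<^sup>2) y"
    by (simp add: powr sq2' numeral_3_eq_3 algebra_simps)
qed

lemma admissible_kdv_grad:
  assumes u: "u \<in> fields r" and r: "3 \<le> r"
  shows "admissible_grad (kdv_grad \<alpha> \<mu> u)"
proof -
  note reg = fields_regular[OF u r]
  have "continuous_on UNIV (kdv_grad \<alpha> \<mu> u)"
    unfolding kdv_grad_def by (intro continuous_intros reg; simp)
  moreover have "periodic2 (kdv_grad \<alpha> \<mu> u)"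
    using reg periodic2_pd1[of "\<partial>\<^sub>1 u"] by (simp add: kdv_grad_def periodic2_def)
  ultimately show ?thesis
    using pd1_kdv_grad(1)[OF assms] by (simp add: admissible_grad_def)
qed

section \<open>Uniqueness of functional derivatives\<close>

text \<open>A class closed under sums, products and derivatives, so that smoothness follows by
  induction. The phase \<open>a\<close> admits translates; \<open>\<omega>\<close> is arbitrary, and
  periodicity is shown separately for the kernels.\<close>

inductive trig_poly :: "(real \<Rightarrow> real) \<Rightarrow> bool" where
  const: "trig_poly (\<lambda>s. c)"
| sin: "trig_poly (\<lambda>s. sin (\<omega> * (s - a)))"
| cos: "trig_poly (\<lambda>s. cos (\<omega> * (s - a)))"
| add: "trig_poly f \<Longrightarrow> trig_poly g \<Longrightarrow> trig_poly (\<lambda>s. f s + g s)"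
| mult: "trig_poly f \<Longrightarrow> trig_poly g \<Longrightarrow> trig_poly (\<lambda>s. f s * g s)"

lemma trig_poly_DERIV:
  "trig_poly f \<Longrightarrow> \<exists>f'. trig_poly f' \<and> (\<forall>s. (f has_real_derivative f' s) (at s))"
proof (induction rule: trig_poly.induct)
  case (const c)
  then show ?case
    by (intro exI[of _ "\<lambda>s. 0"]) (auto intro: trig_poly.intros)
next
  case (sin \<omega> a)
  then show ?case
    by (intro exI[of _ "\<lambda>s. \<omega> * cos (\<omega> * (s - a))"])
      (auto intro!: trig_poly.intros derivative_eq_intros)
next
  case (cos \<omega> a)
  have "trig_poly (\<lambda>s. - \<omega> * sin (\<omega> * (s - a)))"
    by (intro trig_poly.const trig_poly.sin trig_poly.mult)
  moreover have "((\<lambda>s. cos (\<omega> * (s - a))) has_real_derivative - \<omega> * sin (\<omega> * (s - a))) (at s)" for s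
    by (auto intro!: derivative_eq_intros)
  ultimately show ?case
    by blast
next
  case (add f g)
  then obtain f' g' where "trig_poly f'" "trig_poly g'"
    "\<And>s. (f has_real_derivative f' s) (at s)" "\<And>s. (g has_real_derivative g' s) (at s)"
    by blast
  then show ?case
    by (intro exI[of _ "\<lambda>s. f' s + g' s"]) (auto intro: trig_poly.intros DERIV_add)
next
  case (mult f g)
  then obtain f' g' where "trig_poly f'" "trig_poly g'"
    "\<And>s. (f has_real_derivative f' s) (at s)" "\<And>s. (g has_real_derivative g' s) (at s)"
    by blast
  with mult.hyps show ?case
    by (intro exI[of _ "\<lambda>s. f' s * g s + g' s * f s"])
      (auto intro!: trig_poly.add trig_poly.mult DERIV_mult)
qed

lemma trig_poly_continuous: "trig_poly f \<Longrightarrow> continuous_on A f"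
  by (meson trig_poly_DERIV DERIV_isCont continuous_at_imp_continuous_on)

lemma trig_poly_product_continuous:
  assumes "trig_poly f" "trig_poly g"
  shows "continuous_on UNIV (\<lambda>y. f (fst y) * g (snd y))"
  by (intro continuous_intros assms[THEN trig_poly_continuous, THEN continuous_on_UNIV_compose])

text \<open>Both partial derivatives are again products of this form, hence the induction with
  \<open>f\<close> and \<open>g\<close> arbitrary.\<close>

lemma C_k_trig_poly:
  "trig_poly f \<Longrightarrow> trig_poly g \<Longrightarrow> C_k k (\<lambda>y. f (fst y) * g (snd y))"
proof (induction k arbitrary: f g)
  case 0
  then show ?case
    by (simp add: trig_poly_product_continuous)
next
  case (Suc k)
  obtain f' g' where f': "trig_poly f'" "\<And>s. (f has_real_derivative f' s) (at s)"
    and g': "trig_poly g'" "\<And>s. (g has_real_derivative g' s) (at s)"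
    using Suc.prems by (meson trig_poly_DERIV)
  have D1: "((\<lambda>s. f s * c) has_real_derivative f' s * c) (at s)" for s c
    by (rule DERIV_cmult_right[OF f'(2)])
  have D2: "((\<lambda>s. c * g s) has_real_derivative c * g' s) (at s)" for s c
    by (rule DERIV_cmult[OF g'(2)])
  have "has_pd1 (\<lambda>y. f (fst y) * g (snd y))"
    by (rule has_pd1I) (simp, rule D1)
  moreover have "has_pd2 (\<lambda>y. f (fst y) * g (snd y))"
    by (rule has_pd2I) (simp, rule D2)
  moreover have "\<partial>\<^sub>1 (\<lambda>y. f (fst y) * g (snd y)) = (\<lambda>y. f' (fst y) * g (snd y))"
    by (rule ext, rule pd1_eqI) (simp add: D1)
  moreover have "\<partial>\<^sub>2 (\<lambda>y. f (fst y) * g (snd y)) = (\<lambda>y. f (fst y) * g' (snd y))"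
    by (rule ext, rule pd2_eqI) (simp add: D2)
  moreover have "continuous_on UNIV (\<lambda>y. f (fst y) * g (snd y))"
    using Suc.prems by (rule trig_poly_product_continuous)
  ultimately show ?case
    using Suc f'(1) g'(1) by simp
qed

text \<open>An unnormalised bump of period 2, which concentrates at \<open>a\<close> as
  \<open>n\<close> grows.\<close>

definition cos_kernel :: "nat \<Rightarrow> real \<Rightarrow> real \<Rightarrow> real" where
  "cos_kernel n a s = (1 + cos (pi * (s - a))) ^ n"

lemma trig_poly_cos_kernel: "trig_poly (cos_kernel n a)"
proof (induction n)
  case 0
  then show ?case
    by (simp add: cos_kernel_def[abs_def] trig_poly.const)
next
  case (Suc n)
  then show ?case
    using trig_poly.mult[OF trig_poly.add[OF trig_poly.const[of 1] trig_poly.cos[of pi a]] Suc]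
    by (simp add: cos_kernel_def[abs_def])
qed

lemma cos_kernel_periodic: "cos_kernel n a (s + 2) = cos_kernel n a s"
  using cos_periodic[of "pi * (s - a)"] by (simp add: cos_kernel_def algebra_simps)

lemma cos_kernel_shift: "cos_kernel n a (s + a) = cos_kernel n 0 s"
  by (simp add: cos_kernel_def)

text \<open>Variations must have zero average in \<open>y\<^sub>1\<close>: a difference of two translates of the same kernel
  does, and it compares the values of \<open>d\<close> at the two points.\<close>

lemma orthogonal_fields_imp_const:
  fixes d :: field
  assumes d: "continuous_on UNIV d" "periodic2 d"
    and orth: "\<And>h. h \<in> fields r \<Longrightarrow> integral sq (\<lambda>y. d y * h y) = 0"
  shows "d (a, z) = d (b, z)"
proof -
  note cont_kernel = trig_poly_continuous[OF trig_poly_cos_kernel]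
  have per: "d (x + 2, y) = d (x, y)" "d (x, y + 2) = d (x, y)" for x y
    using d(2) by (auto simp: periodic2_def)
  \<comment> \<open>Recentres a kernel at 0, the only point at which
    \<open>orthogonal_cos_powers_zero\<close> tests.\<close>
  have shift: "integral {-1..1} (\<lambda>s. f s * cos_kernel n c s)
      = integral {-1..1} (\<lambda>s. f (s + c) * cos_kernel n 0 s)"
    if "continuous_on UNIV f" "\<And>s. f (s + 2) = f s" for f n c
    using integral_periodic_shift[of "\<lambda>s. f s * cos_kernel n c s" c] that
    by (simp add: cos_kernel_periodic cos_kernel_shift continuous_intros cont_kernel)
  \<comment> \<open>The difference is written with \<open>(-1) *\<close> to fit the closure rules of
    \<open>trig_poly\<close>.\<close>
  define \<phi> where "\<phi> n s = cos_kernel n a s + (-1) * cos_kernel n b s" for n s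
  have \<phi>_trig: "trig_poly (\<phi> n)" for n
    unfolding \<phi>_def[abs_def] by (intro trig_poly.intros(1,4,5) trig_poly_cos_kernel)
  note \<phi>_cont = trig_poly_continuous[OF \<phi>_trig]
  have \<phi>_per: "\<phi> n (s + 2) = \<phi> n s" for n s
    by (simp add: \<phi>_def cos_kernel_periodic)
  have \<phi>_avg: "integral {-1..1} (\<phi> n) = 0" for n
  proof -
    have "integral {-1..1} (\<phi> n)
        = integral {-1..1} (cos_kernel n a) - integral {-1..1} (cos_kernel n b)"
      by (simp add: \<phi>_def[abs_def] integral_diff integrable_continuous_real cont_kernel)
    then show ?thesis
      using shift[of "\<lambda>s. 1" n a] shift[of "\<lambda>s. 1" n b] by simp
  qed
  \<comment> \<open>The two variables are localised in turn: first \<open>y2\<close> at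
    \<open>z\<close> with \<open>n\<close> fixed, which gives \<open>F n z = 0\<close>, then
    \<open>y1\<close> by varying \<open>n\<close>.\<close>
  define F where "F n y2 = integral {-1..1} (\<lambda>y1. d (y1, y2) * \<phi> n y1)" for n y2
  have F_cont: "continuous_on A (F n)" for A n
  proof -
    have "continuous_on (A \<times> cbox (-1) 1) (\<lambda>(y2, y1). d (y1, y2) * \<phi> n y1)"
      unfolding case_prod_beta'
      by (intro continuous_intros continuous_on_UNIV_compose[OF d(1)] continuous_on_UNIV_compose[OF \<phi>_cont])
    then have "continuous_on A (\<lambda>y2. integral (cbox (-1) 1) (\<lambda>y1. d (y1, y2) * \<phi> n y1))"
      by (rule integral_continuous_on_param)
    then show ?thesis
      by (simp add: F_def[abs_def])
  qed
  have F_per: "F n (s + 2) = F n s" for n s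
    by (simp add: F_def per)
  have "F n (0 + z) = 0" for n
  proof (rule orthogonal_cos_powers_zero[where f = "\<lambda>s. F n (s + z)"])
    show "continuous_on {-1..1} (\<lambda>s. F n (s + z))"
      by (intro continuous_on_UNIV_compose[OF F_cont] continuous_intros)
  next
    fix m
    define h where "h y = \<phi> n (fst y) * cos_kernel m z (snd y)" for y :: "real \<times> real"
    have Ck: "C_k k h" for k
      unfolding h_def[abs_def] by (intro C_k_trig_poly \<phi>_trig trig_poly_cos_kernel)
    then have "C_k 0 h" .
    then have h_cont: "continuous_on UNIV h"
      by simp
    have h: "h \<in> fields r"
      using Ck by (simp add: fields_def periodic2_def zero_avg1_def)
        (simp add: h_def \<phi>_per \<phi>_avg cos_kernel_periodic)
    have "0 = integral sq (\<lambda>y. d y * h y)"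
      using orth[OF h] by simp
    also have "\<dots> = integral {-1..1} (\<lambda>y2. integral {-1..1} (\<lambda>y1. d (y1, y2) * h (y1, y2)))"
      by (intro integral_sq_iterated continuous_intros d h_cont)
    also have "\<dots> = integral {-1..1} (\<lambda>y2. F n y2 * cos_kernel m z y2)"
      by (simp add: F_def h_def flip: mult.assoc)
    also have "\<dots> = integral {-1..1} (\<lambda>s. F n (s + z) * cos_kernel m 0 s)"
      by (rule shift) (auto simp: F_cont F_per)
    finally show "integral {-1..1} (\<lambda>s. F n (s + z) * (1 + cos (pi * s)) ^ m) = 0"
      by (simp add: cos_kernel_def)
  qed
  then have F0: "F n z = 0" for n
    by simp
  \<comment> \<open>Recentring both kernels turns \<open>F n z\<close> into a pairing of this
    difference with the kernel at 0.\<close>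
  have "d (0 + a, z) - d (0 + b, z) = 0"
  proof (rule orthogonal_cos_powers_zero[where f = "\<lambda>s. d (s + a, z) - d (s + b, z)"])
    show "continuous_on {-1..1} (\<lambda>s. d (s + a, z) - d (s + b, z))"
      by (intro continuous_intros continuous_on_UNIV_compose[OF d(1)])
  next
    fix n
    have int: "(\<lambda>s. d (s + c, z) * cos_kernel n 0 s) integrable_on {-1..1}"
      "(\<lambda>s. d (s, z) * cos_kernel n c s) integrable_on {-1..1}" for c
      by (intro integrable_continuous_real continuous_intros cont_kernel continuous_on_UNIV_compose[OF d(1)])+
    have "integral {-1..1} (\<lambda>s. (d (s + a, z) - d (s + b, z)) * cos_kernel n 0 s)
        = integral {-1..1} (\<lambda>s. d (s + a, z) * cos_kernel n 0 s)
          - integral {-1..1} (\<lambda>s. d (s + b, z) * cos_kernel n 0 s)"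
      by (simp add: left_diff_distrib integral_diff int)
    also have "\<dots> = integral {-1..1} (\<lambda>s. d (s, z) * cos_kernel n a s)
          - integral {-1..1} (\<lambda>s. d (s, z) * cos_kernel n b s)"
      using shift[of "\<lambda>s. d (s, z)"] per continuous_on_slice[OF d(1)] by simp
    also have "\<dots> = F n z"
      by (simp add: F_def \<phi>_def right_diff_distrib integral_diff int)
    finally show "integral {-1..1} (\<lambda>s. (d (s + a, z) - d (s + b, z)) * (1 + cos (pi * s)) ^ n) = 0"
      by (simp add: F0 cos_kernel_def)
  qed
  then show ?thesis
    by simp
qed

text \<open>On each line of fixed \<open>y2\<close> the two gradients differ by a constant, which
  leaves the Hamiltonian vector field well defined.\<close>

lemma admissible_grad_pd1_unique:
  assumes g: "admissible_grad g" and g': "admissible_grad g'"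
    and eq: "\<And>h. h \<in> fields r \<Longrightarrow> integral sq (\<lambda>y. g y * h y) = integral sq (\<lambda>y. g' y * h y)"
  shows "\<partial>\<^sub>1 g = \<partial>\<^sub>1 g'"
proof
  fix y :: "real \<times> real"
  have G: "continuous_on UNIV g" "periodic2 g" and G': "continuous_on UNIV g'" "periodic2 g'" "has_pd1 g'"
    using g g' by (auto simp: admissible_grad_def)
  have "g (a, z) - g' (a, z) = g (b, z) - g' (b, z)" for a b z
  proof (rule orthogonal_fields_imp_const[where d = "\<lambda>y. g y - g' y" and r = r])
    show "continuous_on UNIV (\<lambda>y. g y - g' y)" "periodic2 (\<lambda>y. g y - g' y)"
      using G G' by (auto simp: periodic2_def intro: continuous_intros)
  next
    fix h
    assume h: "h \<in> fields r"
    then have "C_k 0 h"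
      by (auto simp: fields_def simp flip: zero_enat_def simp del: C_k.simps)
    then have "(\<lambda>y. g y * h y) integrable_on sq" "(\<lambda>y. g' y * h y) integrable_on sq"
      using G G' by (auto intro!: integrable_sq continuous_intros)
    then show "integral sq (\<lambda>y. (g y - g' y) * h y) = 0"
      using eq[OF h] by (simp add: left_diff_distrib integral_diff)
  qed
  from this[of _ "snd y" 0]
  have *: "(\<lambda>s. g (s, snd y)) = (\<lambda>s. g' (s, snd y) + (g (0, snd y) - g' (0, snd y)))"
    by (simp add: fun_eq_iff algebra_simps)
  have "((\<lambda>s. g' (s, snd y) + (g (0, snd y) - g' (0, snd y))) has_real_derivative
      \<partial>\<^sub>1 g' (fst y, snd y) + 0) (at (fst y))"
    by (intro DERIV_add has_pd1_DERIV G' DERIV_const)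
  then show "\<partial>\<^sub>1 g y = \<partial>\<^sub>1 g' y"
    by (intro pd1_eqI) (simp only: * prod.collapse add_0_right)
qed

section \<open>Hamilton's equations\<close>

text \<open>One energy stays constant during a variation, and uniqueness of derivatives turns the
  condition on the other into an equation of integrals.\<close>

lemma func_deriv_averaged:
  fixes \<alpha> \<mu> :: real and r :: enat
  assumes \<xi>: "\<xi> \<in> fields r" and \<eta>: "\<eta> \<in> fields r" and r: "3 \<le> r"
  defines "K \<equiv> \<lambda>w. h0 w + \<mu>\<^sup>2 * flow_avg (F2 \<alpha>) w"
  shows "func_deriv_xi r K (\<xi>, \<eta>) g \<longleftrightarrow> admissible_grad g \<and>
      (\<forall>h\<in>fields r. integral sq (\<lambda>y. g y * h y) = integral sq (\<lambda>y. kdv_grad \<alpha> \<mu> \<xi> y * h y))"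
    and "func_deriv_eta r K (\<xi>, \<eta>) g \<longleftrightarrow> admissible_grad g \<and>
      (\<forall>h\<in>fields r. integral sq (\<lambda>y. g y * h y) = integral sq (\<lambda>y. kdv_grad \<alpha> \<mu> \<eta> y * h y))"
proof -
  have D: "((\<lambda>e. kdv_energy \<alpha> \<mu> (\<lambda>y. u y + e * h y) + c) has_real_derivative D) (at 0) \<longleftrightarrow>
      D = integral sq (\<lambda>y. kdv_grad \<alpha> \<mu> u y * h y)"
    if "u \<in> fields r" "h \<in> fields r" for u h c D
  proof -
    have "((\<lambda>e. kdv_energy \<alpha> \<mu> (\<lambda>y. u y + e * h y) + c) has_real_derivative
        integral sq (\<lambda>y. kdv_grad \<alpha> \<mu> u y * h y)) (at 0)"
      using DERIV_add[OF kdv_energy_has_gradient[OF that r] DERIV_const[of c]] by simp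
    then show ?thesis
      using DERIV_unique by blast
  qed
  have K_xi: "K (\<lambda>y. \<xi> y + e * h y, \<eta>)
      = kdv_energy \<alpha> \<mu> (\<lambda>y. \<xi> y + e * h y) + kdv_energy \<alpha> \<mu> \<eta>" if "h \<in> fields r" for e h
    unfolding K_def by (rule averaged_hamiltonian[OF fields_add_scaled[OF \<xi> that] \<eta> r])
  \<comment> \<open>The varied energy is put first, the form that \<open>D\<close> expects.\<close>
  have K_eta: "K (\<xi>, \<lambda>y. \<eta> y + e * h y)
      = kdv_energy \<alpha> \<mu> (\<lambda>y. \<eta> y + e * h y) + kdv_energy \<alpha> \<mu> \<xi>" if "h \<in> fields r" for e h
    unfolding K_def
    by (subst add.commute[of "kdv_energy \<alpha> \<mu> (\<lambda>y. \<eta> y + e * h y)"])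
      (rule averaged_hamiltonian[OF \<xi> fields_add_scaled[OF \<eta> that] r])
  show "func_deriv_xi r K (\<xi>, \<eta>) g \<longleftrightarrow> admissible_grad g \<and>
      (\<forall>h\<in>fields r. integral sq (\<lambda>y. g y * h y) = integral sq (\<lambda>y. kdv_grad \<alpha> \<mu> \<xi> y * h y))"
    by (simp add: func_deriv_xi_def K_xi D \<xi> cong: ball_cong)
  show "func_deriv_eta r K (\<xi>, \<eta>) g \<longleftrightarrow> admissible_grad g \<and>
      (\<forall>h\<in>fields r. integral sq (\<lambda>y. g y * h y) = integral sq (\<lambda>y. kdv_grad \<alpha> \<mu> \<eta> y * h y))"
    by (simp add: func_deriv_eta_def K_eta D \<eta> cong: ball_cong)
qed

text \<open>Existence takes \<open>kdv_grad\<close> itself as gradient; uniqueness is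
  \<open>admissible_grad_pd1_unique\<close>.\<close>

lemma ham_vf_averaged:
  fixes \<alpha> \<mu> :: real and r :: enat
  assumes \<xi>: "\<xi> \<in> fields r" and \<eta>: "\<eta> \<in> fields r" and r: "3 \<le> r"
  shows "ham_vf r (\<lambda>w. h0 w + \<mu>\<^sup>2 * flow_avg (F2 \<alpha>) w) (\<xi>, \<eta>) V \<longleftrightarrow>
    V = ((\<lambda>y. - \<partial>\<^sub>1 (kdv_grad \<alpha> \<mu> \<xi>) y), (\<lambda>y. \<partial>\<^sub>1 (kdv_grad \<alpha> \<mu> \<eta>) y))"
proof
  assume "ham_vf r (\<lambda>w. h0 w + \<mu>\<^sup>2 * flow_avg (F2 \<alpha>) w) (\<xi>, \<eta>) V"
  then obtain g1 g2 where g: "admissible_grad g1" "admissible_grad g2"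
      "\<And>h. h \<in> fields r \<Longrightarrow>
        integral sq (\<lambda>y. g1 y * h y) = integral sq (\<lambda>y. kdv_grad \<alpha> \<mu> \<xi> y * h y)"
      "\<And>h. h \<in> fields r \<Longrightarrow>
        integral sq (\<lambda>y. g2 y * h y) = integral sq (\<lambda>y. kdv_grad \<alpha> \<mu> \<eta> y * h y)"
    and V: "V = ((\<lambda>y. - \<partial>\<^sub>1 g1 y), (\<lambda>y. \<partial>\<^sub>1 g2 y))"
    unfolding ham_vf_def func_deriv_averaged[OF assms] by blast
  have "\<partial>\<^sub>1 g1 = \<partial>\<^sub>1 (kdv_grad \<alpha> \<mu> \<xi>)" "\<partial>\<^sub>1 g2 = \<partial>\<^sub>1 (kdv_grad \<alpha> \<mu> \<eta>)"
    using g by (auto intro!: admissible_grad_pd1_unique admissible_kdv_grad \<xi> \<eta> r)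
  with V show "V = ((\<lambda>y. - \<partial>\<^sub>1 (kdv_grad \<alpha> \<mu> \<xi>) y), (\<lambda>y. \<partial>\<^sub>1 (kdv_grad \<alpha> \<mu> \<eta>) y))"
    by simp
next
  assume "V = ((\<lambda>y. - \<partial>\<^sub>1 (kdv_grad \<alpha> \<mu> \<xi>) y), (\<lambda>y. \<partial>\<^sub>1 (kdv_grad \<alpha> \<mu> \<eta>) y))"
  then show "ham_vf r (\<lambda>w. h0 w + \<mu>\<^sup>2 * flow_avg (F2 \<alpha>) w) (\<xi>, \<eta>) V"
    unfolding ham_vf_def func_deriv_averaged[OF assms]
    using admissible_kdv_grad[OF \<xi> r] admissible_kdv_grad[OF \<eta> r] by blast
qed

theorem corollary4p5:
  fixes \<alpha> \<mu> :: real and r :: enat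
  assumes "\<alpha> \<noteq> 0" and "\<mu> > 0" and "r \<ge> 3"
  shows "(\<forall>\<xi>\<in>fields r. \<forall>\<eta>\<in>fields r. \<forall>V.
      ham_vf r (\<lambda>w. h0 w + \<mu>\<^sup>2 * flow_avg (F2 \<alpha>) w) (\<xi>, \<eta>) V \<longleftrightarrow>
      V = ((\<lambda>y. - \<partial>\<^sub>1 \<xi> y - \<mu>\<^sup>2 / 24 * (\<partial>\<^sub>1 ^^ 3) \<xi> y
                - \<mu>\<^sup>2 * \<alpha> / (2 * sqrt 2) * \<partial>\<^sub>1 (\<lambda>z. (\<xi> z)\<^sup>2) y),
           (\<lambda>y. \<partial>\<^sub>1 \<eta> y + \<mu>\<^sup>2 / 24 * (\<partial>\<^sub>1 ^^ 3) \<eta> y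
                + \<mu>\<^sup>2 * \<alpha> / (2 * sqrt 2) * \<partial>\<^sub>1 (\<lambda>z. (\<eta> z)\<^sup>2) y))) \<and>
    (\<forall>(S :: real set) \<xi> \<eta>. (\<forall>\<tau>\<in>S. \<xi> \<tau> \<in> fields r \<and> \<eta> \<tau> \<in> fields r) \<longrightarrow>
      (hamilton_eqs r (\<lambda>w. h0 w + \<mu>\<^sup>2 * flow_avg (F2 \<alpha>) w) S \<xi> \<eta> \<longleftrightarrow>
       (\<forall>\<tau>\<in>S. \<forall>y.
         ((\<lambda>t. \<xi> t y) has_real_derivative
            (- \<partial>\<^sub>1 (\<xi> \<tau>) y - \<mu>\<^sup>2 / 24 * (\<partial>\<^sub>1 ^^ 3) (\<xi> \<tau>) y
             - \<mu>\<^sup>2 * \<alpha> / (2 * sqrt 2) * \<partial>\<^sub>1 (\<lambda>z. (\<xi> \<tau> z)\<^sup>2) y)) (at \<tau> within S) \<and>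
         ((\<lambda>t. \<eta> t y) has_real_derivative
            (\<partial>\<^sub>1 (\<eta> \<tau>) y + \<mu>\<^sup>2 / 24 * (\<partial>\<^sub>1 ^^ 3) (\<eta> \<tau>) y
             + \<mu>\<^sup>2 * \<alpha> / (2 * sqrt 2) * \<partial>\<^sub>1 (\<lambda>z. (\<eta> \<tau> z)\<^sup>2) y)) (at \<tau> within S))))"
  (is "(\<forall>\<xi>\<in>_. \<forall>\<eta>\<in>_. \<forall>V. ?vector_field_at \<xi> \<eta> V) \<and> ?equations")
proof
  show vf: "\<forall>\<xi>\<in>fields r. \<forall>\<eta>\<in>fields r. \<forall>V. ?vector_field_at \<xi> \<eta> V"
  proof (intro ballI allI)
    fix \<xi> \<eta> V
    assume \<xi>: "\<xi> \<in> fields r" and \<eta>: "\<eta> \<in> fields r"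
    have neg: "- (a + b + c) = - a - b - c" for a b c :: real
      by simp
    show "?vector_field_at \<xi> \<eta> V"
      by (simp only: ham_vf_averaged[OF \<xi> \<eta> assms(3)] pd1_kdv_grad(2)[OF \<xi> assms(3)]
          pd1_kdv_grad(2)[OF \<eta> assms(3)] neg)
  qed
  \<comment> \<open>The first part fixes the pair \<open>a\<close>, \<open>b\<close> in
    \<open>hamilton_eqs\<close>, so the existential collapses to the explicit right-hand
    sides.\<close>
  show ?equations
    unfolding hamilton_eqs_def using vf by simp
qed

end
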